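(* Let $\mathcal{P}$ be a finite poset, let $m$ be a positive integer, and let $\mathcal{C}_m$ be the chain with $m$ elements on the ground set $\{1,2,\ldots,m\}$. Then there is an isomorphism of posets $\mathcal{I}(\mathcal{P}\times\mathcal{C}_m)\cong\mathcal{I}(\mathcal{P})^{[m]}$.
   Context: For a poset $\mathcal{Q}=(Q,\leq)$, a set $I\subseteq Q$ is an order ideal if $y\in I$ and $x\leq y$ imply $x\in I$; $\mathcal{I}(\mathcal{Q})$ denotes the set of all order ideals of $\mathcal{Q}$, partially ordered by inclusion. The direct product $\mathcal{P}\times\mathcal{Q}$ carries the componentwise order. For a poset $\mathcal{Q}=(Q,\leq)$ and an integer $m>0$, the poset of $m$-multichains $\mathcal{Q}^{[m]}$ is the set $\{(x_1,\ldots,x_m)\in Q^m\mid x_1\leq x_2\leq\cdots\leq x_m\}$ with the componentwise order. *)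

theory Defs
  imports "HOL-Algebra.Order"
begin

definition order_ideal :: "'a gorder \<Rightarrow> 'a set \<Rightarrow> bool" where
  "order_ideal Q I \<longleftrightarrow>
     I \<subseteq> carrier Q \<and> (\<forall>y\<in>I. \<forall>x\<in>carrier Q. x \<sqsubseteq>\<^bsub>Q\<^esub> y \<longrightarrow> x \<in> I)"

definition ideal_poset :: "'a gorder \<Rightarrow> 'a set gorder" where
  "ideal_poset Q = \<lparr>carrier = {I. order_ideal Q I}, eq = (=), le = (\<subseteq>)\<rparr>"

definition product_poset :: "'a gorder \<Rightarrow> 'b gorder \<Rightarrow> ('a \<times> 'b) gorder" where
  "product_poset P Q =
     \<lparr>carrier = carrier P \<times> carrier Q, eq = (=),
      le = (\<lambda>u v. fst u \<sqsubseteq>\<^bsub>P\<^esub> fst v \<and> snd u \<sqsubseteq>\<^bsub>Q\<^esub> snd v)\<rparr>"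

definition chain_poset :: "nat \<Rightarrow> nat gorder" where
  "chain_poset m = \<lparr>carrier = {1..m}, eq = (=), le = (\<le>)\<rparr>"

(* The m-tuple (x_1, ..., x_m) is the list [x_1, ..., x_m];
   "successively" compares neighbouring entries only: x_1 <= x_2, x_2 <= x_3, ... *)
definition multichain_poset :: "'a gorder \<Rightarrow> nat \<Rightarrow> 'a list gorder" where
  "multichain_poset Q m =
     \<lparr>carrier = {xs. length xs = m \<and> set xs \<subseteq> carrier Q \<and> successively (le Q) xs},
      eq = (=), le = list_all2 (le Q)\<rparr>"

(* That both structures are partial orders is part of the notion of isomorphism. *)
definition poset_isomorphism :: "'a gorder \<Rightarrow> 'b gorder \<Rightarrow> ('a \<Rightarrow> 'b) \<Rightarrow> bool" where
  "poset_isomorphism X Y f \<longleftrightarrow>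
     partial_order X \<and> partial_order Y \<and>
     bij_betw f (carrier X) (carrier Y) \<and>
     (\<forall>x\<in>carrier X. \<forall>y\<in>carrier X. x \<sqsubseteq>\<^bsub>X\<^esub> y \<longleftrightarrow> f x \<sqsubseteq>\<^bsub>Y\<^esub> f y)"

definition poset_isomorphic :: "'a gorder \<Rightarrow> 'b gorder \<Rightarrow> bool" where
  "poset_isomorphic X Y \<longleftrightarrow> (\<exists>f. poset_isomorphism X Y f)"

end

(* An order ideal J of P x C_m is determined by its slices {p. (p, k) \<in> J}. Each slice is an
   order ideal of P, and the slices shrink as k grows, so listing them for k = m, ..., 1 gives an
   m-multichain. Conversely every m-multichain of ideals arises this way, and inclusion of ideals
   is inclusion of slices. *)

theory Submission
  imports Defs
begin

text \<open>The locale \<open>partial_order\<close> is stated over a setoid equality. Once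
  \<open>eq\<close> is \<open>(=)\<close>, its equivalence and congruence axioms are trivial and
  only the three usual order laws remain.\<close>

lemma partial_orderI:
  assumes "eq L = (=)"
    and "\<And>x. x \<in> carrier L \<Longrightarrow> x \<sqsubseteq>\<^bsub>L\<^esub> x"
    and "\<And>x y. \<lbrakk>x \<in> carrier L; y \<in> carrier L; x \<sqsubseteq>\<^bsub>L\<^esub> y; y \<sqsubseteq>\<^bsub>L\<^esub> x\<rbrakk> \<Longrightarrow> x = y"
    and "\<And>x y z. \<lbrakk>x \<in> carrier L; y \<in> carrier L; z \<in> carrier L; x \<sqsubseteq>\<^bsub>L\<^esub> y; y \<sqsubseteq>\<^bsub>L\<^esub> z\<rbrakk> \<Longrightarrow> x \<sqsubseteq>\<^bsub>L\<^esub> z"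
  shows "partial_order L"
  by unfold_locales (simp_all only: assms(1), auto intro: assms(2,4) dest: assms(3))

lemma partial_order_ideal_poset: "partial_order (ideal_poset Q)"
  by (rule partial_orderI) (auto simp: ideal_poset_def)

lemma partial_order_multichain_poset:
  assumes "partial_order Q"
  shows "partial_order (multichain_poset Q m)"
proof -
  interpret Q: partial_order Q by fact
  \<comment> \<open>The laws of \<open>Q\<close> hold only on its carrier, so each use of them below
    goes with membership of the entries; \<open>le\<close> then makes the order laws
    entrywise.\<close>
  have nth: "length xs = m" "\<And>i. i < m \<Longrightarrow> xs ! i \<in> carrier Q"
    if "xs \<in> carrier (multichain_poset Q m)" for xs
    using that by (auto simp: multichain_poset_def)
  have le: "xs \<sqsubseteq>\<^bsub>multichain_poset Q m\<^esub> ys \<longleftrightarrow> (\<forall>i<m. xs ! i \<sqsubseteq>\<^bsub>Q\<^esub> ys ! i)"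
    if "xs \<in> carrier (multichain_poset Q m)" "ys \<in> carrier (multichain_poset Q m)" for xs ys
    using that by (simp add: multichain_poset_def list_all2_conv_all_nth)
  show ?thesis
  proof (rule partial_orderI)
    fix xs ys
    assume *: "xs \<in> carrier (multichain_poset Q m)" "ys \<in> carrier (multichain_poset Q m)"
      and "xs \<sqsubseteq>\<^bsub>multichain_poset Q m\<^esub> ys" "ys \<sqsubseteq>\<^bsub>multichain_poset Q m\<^esub> xs"
    then have "xs ! i = ys ! i" if "i < m" for i
      using that le[OF *] le[OF *(2,1)] by (intro Q.le_antisym nth(2)[OF *(1)] nth(2)[OF *(2)]) auto
    then show "xs = ys"
      using nth(1)[OF *(1)] nth(1)[OF *(2)] by (intro nth_equalityI) auto
  next
    fix xs ys zs
    assume *: "xs \<in> carrier (multichain_poset Q m)" "ys \<in> carrier (multichain_poset Q m)"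
      "zs \<in> carrier (multichain_poset Q m)"
      and "xs \<sqsubseteq>\<^bsub>multichain_poset Q m\<^esub> ys" "ys \<sqsubseteq>\<^bsub>multichain_poset Q m\<^esub> zs"
    then have "xs ! i \<sqsubseteq>\<^bsub>Q\<^esub> zs ! i" if "i < m" for i
      using that le[OF *(1,2)] le[OF *(2,3)]
      by (intro Q.le_trans[of "xs ! i" "ys ! i" "zs ! i"] nth(2)[OF *(1)] nth(2)[OF *(2)]
          nth(2)[OF *(3)]) auto
    then show "xs \<sqsubseteq>\<^bsub>multichain_poset Q m\<^esub> zs"
      using le[OF *(1,3)] by blast
  next
    fix xs assume *: "xs \<in> carrier (multichain_poset Q m)"
    show "xs \<sqsubseteq>\<^bsub>multichain_poset Q m\<^esub> xs"
      using le[OF * *] nth(2)[OF *] by blast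
  qed (simp add: multichain_poset_def)
qed

text \<open>The bound \<open>k \<le> m\<close> on the lower point comes for free from
  \<open>k \<le> l\<close>, because \<open>J\<close> contains only pairs with
  \<open>l \<le> m\<close>.\<close>

lemma order_ideal_product_chain_iff:
  "order_ideal (product_poset P (chain_poset m)) J \<longleftrightarrow>
     J \<subseteq> carrier P \<times> {1..m} \<and>
     (\<forall>q l p k. (q, l) \<in> J \<and> p \<in> carrier P \<and> p \<sqsubseteq>\<^bsub>P\<^esub> q \<and> 1 \<le> k \<and> k \<le> l \<longrightarrow> (p, k) \<in> J)"
  (is "_ = (?sub \<and> _)")
proof -
  have "order_ideal (product_poset P (chain_poset m)) J \<longleftrightarrow> J \<subseteq> carrier P \<times> {1..m} \<and>
    (\<forall>q l p k. (q, l) \<in> J \<and> p \<in> carrier P \<and> p \<sqsubseteq>\<^bsub>P\<^esub> q \<and> k \<in> {1..m} \<and> k \<le> l \<longrightarrow> (p, k) \<in> J)"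
    unfolding order_ideal_def product_poset_def chain_poset_def by (simp add: Ball_def) blast
  moreover have "k \<in> {1..m} \<and> k \<le> l \<longleftrightarrow> 1 \<le> k \<and> k \<le> l" if ?sub "(q, l) \<in> J" for q l k
    using that by auto
  ultimately show ?thesis by meson
qed

text \<open>Transitivity of inclusion upgrades the neighbour comparisons of
  \<open>successively\<close> to all index pairs, so that distant slices can be compared without an
  induction.\<close>

lemma mem_multichain_ideal_poset_iff:
  "xs \<in> carrier (multichain_poset (ideal_poset P) m) \<longleftrightarrow>
     length xs = m \<and> (\<forall>i<m. order_ideal P (xs ! i)) \<and>
     (\<forall>i j. i \<le> j \<longrightarrow> j < m \<longrightarrow> xs ! i \<subseteq> xs ! j)"
proof -
  have "successively (\<subseteq>) xs \<longleftrightarrow> (\<forall>i j. i \<le> j \<longrightarrow> j < length xs \<longrightarrow> xs ! i \<subseteq> xs ! j)"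
    by (subst successively_conv_sorted_wrt)
      (auto simp: sorted_wrt_iff_nth_less le_less intro: transpI)
  then show ?thesis
    by (auto simp: multichain_poset_def ideal_poset_def all_set_conv_all_nth subset_iff
        in_set_conv_nth)
qed

text \<open>Slices shrink with the chain coordinate, so the entry at (zero-based) index \<open>i\<close> is the one
  at coordinate \<open>m - i\<close>.\<close>

definition slices :: "nat \<Rightarrow> ('a \<times> nat) set \<Rightarrow> 'a set list" where
  "slices m J = map (\<lambda>i. {p. (p, m - i) \<in> J}) [0..<m]"

text \<open>The range of \<open>k\<close> guards the index: \<open>k = 0\<close> would read past the
  end of a list of length \<open>m\<close>, and truncated subtraction would send every
  \<open>k > m\<close> to index 0.\<close>

definition unslice :: "nat \<Rightarrow> 'a set list \<Rightarrow> ('a \<times> nat) set" where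
  "unslice m xs = {(p, k). k \<in> {1..m} \<and> p \<in> xs ! (m - k)}"

text \<open>Reversing the index twice is harmless, since \<open>m - (m - k) = k\<close> for
  \<open>k \<le> m\<close>; the assumption confines \<open>J\<close> to the levels that
  \<open>slices\<close> records.\<close>

lemma unslice_slices: "J \<subseteq> A \<times> {1..m} \<Longrightarrow> unslice m (slices m J) = J"
  by (auto simp: unslice_def slices_def)

lemma slices_unslice: "length xs = m \<Longrightarrow> slices m (unslice m xs) = xs"
  by (rule nth_equalityI) (auto simp: unslice_def slices_def)

text \<open>Closure of \<open>J\<close> is used in each coordinate separately: lowering
  \<open>p\<close> at a fixed level makes a slice an ideal, lowering the level at a fixed
  \<open>p\<close> (with reflexivity of \<open>P\<close>) nests the slices.\<close>

lemma slices_in_multichain_poset: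
  assumes "partial_order P" and "order_ideal (product_poset P (chain_poset m)) J"
  shows "slices m J \<in> carrier (multichain_poset (ideal_poset P) m)"
proof -
  interpret partial_order P by fact
  have J: "J \<subseteq> carrier P \<times> {1..m}"
    "\<And>q l p k. \<lbrakk>(q, l) \<in> J; p \<in> carrier P; p \<sqsubseteq>\<^bsub>P\<^esub> q; 1 \<le> k; k \<le> l\<rbrakk> \<Longrightarrow> (p, k) \<in> J"
    using assms(2) unfolding order_ideal_product_chain_iff by blast+
  \<comment> \<open>For \<open>k\<close> outside \<open>{1..m}\<close> the slice is empty, hence
    still an ideal.\<close>
  have "order_ideal P {p. (p, k) \<in> J}" for k
    unfolding order_ideal_def
  proof (intro conjI ballI impI)
    show "{p. (p, k) \<in> J} \<subseteq> carrier P" using J(1) by auto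
  next
    fix q p assume "q \<in> {p. (p, k) \<in> J}" "p \<in> carrier P" "p \<sqsubseteq>\<^bsub>P\<^esub> q"
    then show "p \<in> {p. (p, k) \<in> J}" using J(1) J(2)[of q k p k] by auto
  qed
  moreover have "{p. (p, m - i) \<in> J} \<subseteq> {p. (p, m - j) \<in> J}" if "i \<le> j" "j < m" for i j
  proof clarify
    fix p assume p: "(p, m - i) \<in> J"
    then have "p \<in> carrier P" using J(1) by auto
    then show "(p, m - j) \<in> J"
      using that by (intro J(2)[OF p]) auto
  qed
  ultimately show ?thesis
    unfolding mem_multichain_ideal_poset_iff by (simp add: slices_def)
qed

lemma unslice_order_ideal:
  assumes "xs \<in> carrier (multichain_poset (ideal_poset P) m)"
  shows "order_ideal (product_poset P (chain_poset m)) (unslice m xs)"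
proof -
  have xs: "\<And>i. i < m \<Longrightarrow> order_ideal P (xs ! i)"
    "\<And>i j. i \<le> j \<Longrightarrow> j < m \<Longrightarrow> xs ! i \<subseteq> xs ! j"
    using assms unfolding mem_multichain_ideal_poset_iff by blast+
  show ?thesis
    unfolding order_ideal_product_chain_iff
  proof (intro conjI allI impI)
    show "unslice m xs \<subseteq> carrier P \<times> {1..m}"
    proof clarify
      fix p k assume "(p, k) \<in> unslice m xs"
      then show "p \<in> carrier P \<and> k \<in> {1..m}"
        using xs(1)[of "m - k"] by (auto simp: unslice_def order_ideal_def)
    qed
  next
    fix q l p k
    assume *: "(q, l) \<in> unslice m xs \<and> p \<in> carrier P \<and> p \<sqsubseteq>\<^bsub>P\<^esub> q \<and> 1 \<le> k \<and> k \<le> l"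
    \<comment> \<open>The descent from \<open>(q, l)\<close> to \<open>(p, k)\<close> passes through
      \<open>(p, l)\<close>: first inside one ideal of the list, then along the multichain, where
      \<open>k \<le> l\<close> gives \<open>m - l \<le> m - k\<close>.\<close>
    then have "p \<in> xs ! (m - l)"
      using xs(1)[of "m - l"] by (auto simp: unslice_def order_ideal_def)
    moreover have "xs ! (m - l) \<subseteq> xs ! (m - k)"
      using * by (intro xs(2) diff_le_mono2) (auto simp: unslice_def)
    ultimately show "(p, k) \<in> unslice m xs"
      using * by (auto simp: unslice_def)
  qed
qed

text \<open>The bound on \<open>J\<close> puts every point \<open>(p, k)\<close> of \<open>J\<close>
  into the entry at index \<open>m - k\<close>, so inclusion of the entries catches all of
  \<open>J\<close>.\<close>

lemma slices_le_iff:
  assumes "J \<subseteq> A \<times> {1..m}"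
  shows "list_all2 (\<subseteq>) (slices m J) (slices m K) \<longleftrightarrow> J \<subseteq> K"
proof
  assume *: "list_all2 (\<subseteq>) (slices m J) (slices m K)"
  show "J \<subseteq> K"
  proof clarify
    fix p k assume "(p, k) \<in> J"
    moreover from this assms have "k \<in> {1..m}" by auto
    moreover from this have "m - k < length (slices m J)" by (auto simp: slices_def)
    then have "slices m J ! (m - k) \<subseteq> slices m K ! (m - k)"
      using * by (rule list_all2_nthD[rotated])
    ultimately show "(p, k) \<in> K" by (auto simp: slices_def)
  qed
qed (auto simp: slices_def list_all2_conv_all_nth)

theorem theorem4p1:
  fixes P :: "'a gorder" and m :: nat
  assumes "partial_order P" and "finite (carrier P)" and "m > 0"
  shows "poset_isomorphic
           (ideal_poset (product_poset P (chain_poset m)))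
           (multichain_poset (ideal_poset P) m)"
proof -
  let ?X = "ideal_poset (product_poset P (chain_poset m))"
  let ?Y = "multichain_poset (ideal_poset P) m"
  have X: "carrier ?X = {J. order_ideal (product_poset P (chain_poset m)) J}"
    by (simp add: ideal_poset_def)
  have sub: "J \<subseteq> carrier P \<times> {1..m}" if "J \<in> carrier ?X" for J
    using that by (simp add: X order_ideal_product_chain_iff)
  have "bij_betw (slices m) (carrier ?X) (carrier ?Y)"
  proof (rule bij_betw_byWitness[where f' = "unslice m"])
    show "\<forall>J\<in>carrier ?X. unslice m (slices m J) = J"
      using sub unslice_slices by blast
    show "\<forall>xs\<in>carrier ?Y. slices m (unslice m xs) = xs"
      by (simp add: mem_multichain_ideal_poset_iff slices_unslice)
    show "slices m ` carrier ?X \<subseteq> carrier ?Y"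
      using slices_in_multichain_poset[OF assms(1)] by (auto simp: X)
    show "unslice m ` carrier ?Y \<subseteq> carrier ?X"
      using unslice_order_ideal by (auto simp: X)
  qed
  moreover have "J \<sqsubseteq>\<^bsub>?X\<^esub> K \<longleftrightarrow> slices m J \<sqsubseteq>\<^bsub>?Y\<^esub> slices m K" if "J \<in> carrier ?X" for J K
    using slices_le_iff[OF sub[OF that]] by (simp add: ideal_poset_def multichain_poset_def)
  \<comment> \<open>Inclusion orders the ideals of both \<open>P\<close> and the product; the order
    on lists inherits its laws from the former.\<close>
  ultimately have "poset_isomorphism ?X ?Y (slices m)"
    unfolding poset_isomorphism_def
    by (simp add: partial_order_ideal_poset partial_order_multichain_poset)
  then show ?thesis unfolding poset_isomorphic_def by blast
qed

end
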